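(* Let $G=(V,P,d)$ be a reversible metric Markov chain with non-negative Ollivier curvature, where $d$ is the combinatorial distance. Let $\rho>0$ and assume that for every $A\subset V$ with $m(A)\ge\frac12$ and every $r>0$, \[ m(V\setminus A_r)\le\exp(-\rho r^2),\qquad A_r=\{x:d(x,A)\le r\}. \] Then $h_{\sqrt{\log}}\ge\frac{P_0}{48}\sqrt\rho$.
   Context: $V$ finite; $P$ with symmetric support, connected; $x\sim y$ iff $x\ne y$, $P(x,y)>0$; $d(x,y)$ is the minimal number of edges on a path; $m$ the probability with $m(x)P(x,y)=m(y)P(y,x)$. $\Delta f(x)=\sum_yP(x,y)(f(y)-f(x))$; Ollivier curvature $\kappa(x,y)=\inf\{(\Delta f(x)-\Delta f(y))/d(x,y): f\ 1\text{-Lipschitz},\ f(y)-f(x)=d(x,y)\}\ge0$ for all $x\sim y$. $P_0=\inf_{x\sim y}P(x,y)d(x,y)^2$. $|\partial W|=\sum_{x\in W,y\notin W}P(x,y)m(x)d(x,y)$. $h_{\sqrt{\log}}=\inf\{|\partial W|/(m(W)\sqrt{\log(1/m(W))}): W\ne\emptyset,\ m(W)\le\frac12\}$. *)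

theory Defs
  imports "HOL-Analysis.Analysis"
begin

definition markov_kernel :: "('a::finite \<Rightarrow> 'a \<Rightarrow> real) \<Rightarrow> bool" where
  "markov_kernel P \<longleftrightarrow> (\<forall>x y. P x y \<ge> 0) \<and> (\<forall>x. (\<Sum>y\<in>UNIV. P x y) = 1)"

definition adj :: "('a \<Rightarrow> 'a \<Rightarrow> real) \<Rightarrow> 'a \<Rightarrow> 'a \<Rightarrow> bool" where
  "adj P x y \<longleftrightarrow> x \<noteq> y \<and> P x y > 0"

definition symmetric_support :: "('a \<Rightarrow> 'a \<Rightarrow> real) \<Rightarrow> bool" where
  "symmetric_support P \<longleftrightarrow> (\<forall>x y. P x y > 0 \<longleftrightarrow> P y x > 0)"

definition connected_chain :: "('a \<Rightarrow> 'a \<Rightarrow> real) \<Rightarrow> bool" where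
  "connected_chain P \<longleftrightarrow> (\<forall>x y. \<exists>n. (adj P ^^ n) x y)"

definition comb_dist :: "('a \<Rightarrow> 'a \<Rightarrow> real) \<Rightarrow> 'a \<Rightarrow> 'a \<Rightarrow> real" where
  "comb_dist P x y = real (LEAST n. (adj P ^^ n) x y)"

definition reversible_prob :: "('a::finite \<Rightarrow> 'a \<Rightarrow> real) \<Rightarrow> ('a \<Rightarrow> real) \<Rightarrow> bool" where
  "reversible_prob P m \<longleftrightarrow> (\<forall>x. m x \<ge> 0) \<and> (\<Sum>x\<in>UNIV. m x) = 1 \<and>
     (\<forall>x y. m x * P x y = m y * P y x)"

definition meas :: "('a \<Rightarrow> real) \<Rightarrow> 'a set \<Rightarrow> real" where
  "meas m W = (\<Sum>x\<in>W. m x)"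

definition laplacian :: "('a::finite \<Rightarrow> 'a \<Rightarrow> real) \<Rightarrow> ('a \<Rightarrow> real) \<Rightarrow> 'a \<Rightarrow> real" where
  "laplacian P f x = (\<Sum>y\<in>UNIV. P x y * (f y - f x))"

definition lip1 :: "('a \<Rightarrow> 'a \<Rightarrow> real) \<Rightarrow> ('a \<Rightarrow> real) \<Rightarrow> bool" where
  "lip1 P f \<longleftrightarrow> (\<forall>u v. \<bar>f u - f v\<bar> \<le> comb_dist P u v)"

definition ollivier_curvature :: "('a::finite \<Rightarrow> 'a \<Rightarrow> real) \<Rightarrow> 'a \<Rightarrow> 'a \<Rightarrow> real" where
  "ollivier_curvature P x y =
     Inf {(laplacian P f x - laplacian P f y) / comb_dist P x y | f.
            lip1 P f \<and> f y - f x = comb_dist P x y}"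

definition P0 :: "('a \<Rightarrow> 'a \<Rightarrow> real) \<Rightarrow> real" where
  "P0 P = Inf {P x y * (comb_dist P x y)\<^sup>2 | x y. adj P x y}"

definition boundary :: "('a \<Rightarrow> 'a \<Rightarrow> real) \<Rightarrow> ('a \<Rightarrow> real) \<Rightarrow> 'a set \<Rightarrow> real" where
  "boundary P m W = (\<Sum>x\<in>W. \<Sum>y\<in>- W. P x y * m x * comb_dist P x y)"

definition h_sqrt_log :: "('a \<Rightarrow> 'a \<Rightarrow> real) \<Rightarrow> ('a \<Rightarrow> real) \<Rightarrow> real" where
  "h_sqrt_log P m = Inf {boundary P m W / (meas m W * sqrt (ln (1 / meas m W))) | W.
                          W \<noteq> {} \<and> meas m W \<le> 1/2}"

definition nbhd :: "('a \<Rightarrow> 'a \<Rightarrow> real) \<Rightarrow> 'a set \<Rightarrow> real \<Rightarrow> 'a set" where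
  "nbhd P A r = {x. \<exists>a\<in>A. comb_dist P x a \<le> r}"

end

theory Submission
  imports Defs
begin

text \<open>
  For any nontrivial set \<open>W\<close> there are a 1-Lipschitz function \<open>g\<close> and a constant \<open>C\<close> with
  \<open>\<Delta> g \<le> C\<close> on \<open>W\<close> and \<open>\<Delta> g \<ge> C\<close> off \<open>W\<close> such that \<open>g\<close> has slope one everywhere except possibly
  on the inner boundary \<open>K\<close> of \<open>W\<close>. Indeed, \<open>g\<close> is the smallest extension of its values on \<open>K\<close>
  outside \<open>W\<close> and the largest one inside. By non-negative curvature \<open>\<Delta> g\<close> is monotone along
  unit-slope geodesics, so it suffices that \<open>\<Delta> g\<close> is constant on \<open>K\<close>. This is arranged by Brouwer's
  theorem for the map \<open>f \<mapsto> (1 + \<Delta>/2) g\<close> on 1-Lipschitz functions modulo constants.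

  Let \<open>w = m(W)\<close> and \<open>L = ln (1/w)\<close>. Both estimates pair \<open>\<Delta> g\<close> with an increasing function of \<open>g\<close>
  by Green's formula, using that \<open>g\<close> concentrates around its median \<open>a\<close>. If \<open>L \<le> 4\<close>, apply this with
  a truncation of \<open>g\<close> on whichever side of \<open>W\<close> the sign of \<open>C\<close> is favourable. If \<open>L > 4\<close>, then
  \<open>C \<ge> -|\<partial>W|/w\<close>. With \<open>exp (\<lambda> min(g, a + R + 1))\<close> and \<open>R = sqrt (L/\<rho>)\<close> a small boundary would make
  the mass of \<open>{g \<ge> a}\<close> smaller than \<open>1/2\<close>.
\<close>

section \<open>Auxiliary facts on finite measures, minima and exponentials\<close>

lemma meas_mono: "(\<And>x. m x \<ge> 0) \<Longrightarrow> A \<subseteq> B \<Longrightarrow> meas m A \<le> meas m (B :: 'a::finite set)"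
  unfolding meas_def by (rule sum_mono2) auto

lemma meas_Un_le:
  assumes "\<And>x. m x \<ge> (0::real)" shows "meas m (A \<union> B) \<le> meas m A + meas m (B :: 'a::finite set)"
  unfolding meas_def using sum.union_inter[of A B m] sum_nonneg[of "A \<inter> B" m] assms by auto

lemma meas_Compl:
  "meas m (- A) = (\<Sum>x\<in>UNIV. m x) - meas m (A :: 'a::finite set)"
  unfolding meas_def using sum.subset_diff[of A UNIV m] by (simp add: Compl_eq_Diff_UNIV)

lemma continuous_on_Min_image:
  fixes F :: "'b \<Rightarrow> 'a::topological_space \<Rightarrow> real"
  assumes "finite K" "K \<noteq> {}" "\<And>k. k \<in> K \<Longrightarrow> continuous_on S (F k)"
  shows "continuous_on S (\<lambda>v. Min ((\<lambda>k. F k v) ` K))"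
  using assms
proof (induction rule: finite_ne_induct)
  case (insert k K)
  then have "continuous_on S (\<lambda>v. min (F k v) (Min ((\<lambda>k. F k v) ` K)))"
    by (intro continuous_on_min) auto
  with insert show ?case by simp
qed auto

text \<open>Supplies the contradiction for \<open>L > 4\<close>, with \<open>exp (- L)\<close> as
  the mass of \<open>W\<close>. Each summand is at most
  \<open>exp (- 11/12 * L) * (2 + L / 48)\<close>, which is below 1/4.\<close>

lemma exp_small_sum_less_half:
  fixes L :: real assumes "L \<ge> 4"
  shows "exp (- L) * (2 + L / 48) + exp (L / 12) * exp (- L) * (2 + L / 48) < 1/2"
proof -
  let ?y = "11/12 * L"
  have "exp (11/12 :: real) \<ge> 2"
    using exp_lower_Taylor_quadratic[of "11/12 :: real"] by (simp add: power2_eq_square)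
  then have "exp (11/12 :: real) ^ 4 \<ge> 2 ^ 4" by (intro power_mono) auto
  then have "exp (11/3 :: real) \<ge> 16" by (simp add: exp_of_nat_mult[symmetric])
  \<comment> \<open>Tangent line of the exponential at \<open>11/3\<close>, the value of
    \<open>?y\<close> at \<open>L = 4\<close>.\<close>
  moreover have "exp (?y - 11/3) \<ge> 1 + (?y - 11/3)" by (rule exp_ge_add_one_self)
  ultimately have "exp (11/3) * exp (?y - 11/3) \<ge> 16 * (1 + (?y - 11/3))"
    using assms by (intro mult_mono) auto
  then have "exp ?y \<ge> 16 * (1 + (?y - 11/3))" by (simp add: exp_add[symmetric])
  then have y: "exp ?y > 4 * (2 + L / 48)" using assms by simp
  have "exp (- ?y) * (4 * (2 + L / 48)) < exp (- ?y) * exp ?y" using y by simp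
  also have "\<dots> = 1" by (simp add: exp_add[symmetric])
  finally have *: "exp (- ?y) * (2 + L / 48) < 1/4" by (simp add: algebra_simps)
  have "exp (L / 12) * exp (- L) = exp (- ?y)" by (simp add: exp_add[symmetric])
  then have "exp (L / 12) * exp (- L) * (2 + L / 48) < 1/4" using * by simp
  moreover have "exp (- L) * (2 + L / 48) \<le> exp (- ?y) * (2 + L / 48)"
    using assms by (intro mult_right_mono) auto
  then have "exp (- L) * (2 + L / 48) < 1/4" using * by (rule le_less_trans)
  ultimately have "exp (- L) * (2 + L / 48) + exp (L / 12) * exp (- L) * (2 + L / 48) < 1/4 + 1/4"
    by (intro add_strict_mono)
  then show ?thesis by simp
qed

section \<open>Reversible chains and their graph distance\<close>

locale reversible_chain =
  fixes P :: "'a::finite \<Rightarrow> 'a \<Rightarrow> real" and m :: "'a \<Rightarrow> real"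
  assumes kernel: "markov_kernel P"
    and supp_sym: "symmetric_support P"
    and conn: "connected_chain P"
    and reversible: "reversible_prob P m"
begin

abbreviation "d \<equiv> comb_dist P"
abbreviation "\<Delta> \<equiv> laplacian P"

lemma P_nonneg: "P x y \<ge> 0" and P_sum: "(\<Sum>y\<in>UNIV. P x y) = 1"
  using kernel by (auto simp: markov_kernel_def)

lemma m_nonneg: "m x \<ge> 0" and m_sum: "(\<Sum>x\<in>UNIV. m x) = 1"
  and m_P_commute: "m x * P x y = m y * P y x"
  using reversible by (auto simp: reversible_prob_def)

lemma adj_commute: "adj P x y \<longleftrightarrow> adj P y x"
  using supp_sym by (auto simp: adj_def symmetric_support_def)

lemma P_eq_0: "x \<noteq> y \<Longrightarrow> \<not> adj P x y \<Longrightarrow> P x y = 0"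
  using P_nonneg[of x y] by (auto simp: adj_def)

lemma dist_path:
  obtains n where "d x y = real n" "(adj P ^^ n) x y"
proof -
  have "\<exists>n. (adj P ^^ n) x y" using conn by (auto simp: connected_chain_def)
  then have "(adj P ^^ (LEAST n. (adj P ^^ n) x y)) x y" by (rule LeastI_ex)
  then show ?thesis by (rule that[rotated]) (simp add: comb_dist_def)
qed

lemma dist_le_path: "(adj P ^^ n) x y \<Longrightarrow> d x y \<le> real n"
  unfolding comb_dist_def by (simp add: Least_le)

lemma dist_nonneg: "d x y \<ge> 0"
  by (simp add: comb_dist_def)

lemma dist_self: "d x x = 0"
  using dist_le_path[of 0 x x] dist_nonneg[of x x] by auto

lemma dist_eq_0: "d x y = 0 \<longleftrightarrow> x = y"
proof
  assume "d x y = 0"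
  then show "x = y" by (metis dist_path of_nat_eq_0_iff relpowp_0_E)
qed (simp add: dist_self)

lemma path_rev: "(adj P ^^ n) x y \<Longrightarrow> (adj P ^^ n) y x"
proof (induction n arbitrary: y)
  case (Suc n)
  then obtain z where "(adj P ^^ n) x z" "adj P z y" by (auto elim: relpowp_Suc_E)
  with Suc.IH adj_commute show ?case by (meson relpowp_Suc_I2)
qed auto

lemma dist_commute: "d x y = d y x"
  by (metis dist_path dist_le_path path_rev antisym)

lemma dist_triangle: "d x z \<le> d x y + d y z"
proof -
  obtain i where i: "d x y = real i" "(adj P ^^ i) x y" by (rule dist_path)
  obtain j where j: "d y z = real j" "(adj P ^^ j) y z" by (rule dist_path)
  have "(adj P ^^ (i + j)) x z" using i j by (auto simp: relpowp_add)
  then show ?thesis using dist_le_path[of "i + j" x z] i j by auto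
qed

lemma dist_ge_1: "x \<noteq> y \<Longrightarrow> d x y \<ge> 1"
  by (metis dist_path dist_eq_0 One_nat_def Suc_leI neq0_conv of_nat_0 of_nat_1 of_nat_le_iff)

lemma dist_adj: "adj P x y \<Longrightarrow> d x y = 1"
  using dist_le_path[of "Suc 0" x y] dist_ge_1[of x y] by (auto simp: adj_def simp del: relpowp.simps)

text \<open>The last vertex before \<open>x\<close> on a geodesic from \<open>k\<close>; the source
  of all neighbours across which a distance extension has slope one.\<close>

lemma dist_step:
  assumes "x \<noteq> k" obtains z where "adj P x z" "d k x = d k z + 1"
proof -
  obtain n where n: "d k x = real n" "(adj P ^^ n) k x" by (rule dist_path)
  with assms obtain j where j: "n = Suc j" by (cases n) auto
  then obtain z where z: "(adj P ^^ j) k z" "adj P z x" using n by (auto elim: relpowp_Suc_E)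
  then have "d k x \<le> d k z + 1" "d k z \<le> real j"
    using dist_triangle[of k x z] dist_adj[of z x] dist_le_path by auto
  with n j z show ?thesis by (intro that[of z]) (auto simp: adj_commute)
qed

text \<open>An edgewise bound telescopes along a shortest path, and symmetry of the distance turns
  the one-sided bound into a two-sided one.\<close>

lemma lip1I:
  assumes "\<And>u v. adj P u v \<Longrightarrow> f u - f v \<le> 1" shows "lip1 P f"
proof -
  have *: "(adj P ^^ n) u v \<Longrightarrow> f u - f v \<le> real n" for n u v
  proof (induction n arbitrary: v)
    case (Suc n)
    then obtain z where "(adj P ^^ n) u z" "adj P z v" by (auto elim: relpowp_Suc_E)
    with Suc.IH[of z] assms[of z v] show ?case by auto
  qed auto
  have "f u - f v \<le> d u v" for u v
    by (metis * dist_path)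
  then show ?thesis unfolding lip1_def by (smt (verit) dist_commute)
qed

lemma lip1D: "lip1 P f \<Longrightarrow> f u - f v \<le> d u v"
  unfolding lip1_def by (smt (verit))

lemma lip1_adjD: "lip1 P f \<Longrightarrow> adj P u v \<Longrightarrow> \<bar>f u - f v\<bar> \<le> 1"
  using dist_adj[of u v] unfolding lip1_def by metis

lemma lip1_uminus: "lip1 P f \<Longrightarrow> lip1 P (\<lambda>x. - f x)"
  unfolding lip1_def by (smt (verit))

section \<open>The Laplacian of Lipschitz functions\<close>

lemma laplacian_uminus: "\<Delta> (\<lambda>x. - f x) x = - \<Delta> f x"
  unfolding laplacian_def sum_negf[symmetric] by (rule sum.cong) (auto simp: algebra_simps)

lemma laplacian_diff: "\<Delta> (\<lambda>x. f x - g x) x = \<Delta> f x - \<Delta> g x"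
  unfolding laplacian_def sum_subtractf[symmetric] by (rule sum.cong) (auto simp: algebra_simps)

lemma laplacian_ge:
  assumes "\<And>y. f y - f x \<ge> - s" shows "\<Delta> f x \<ge> - s"
proof -
  have "- s = (\<Sum>y\<in>UNIV. P x y * - s)" by (simp only: sum_distrib_right[symmetric] P_sum mult_1)
  also have "\<dots> \<le> \<Delta> f x"
    unfolding laplacian_def by (intro sum_mono mult_left_mono assms P_nonneg)
  finally show ?thesis .
qed

lemma laplacian_le:
  assumes "\<And>y. f y - f x \<le> s" shows "\<Delta> f x \<le> s"
  using laplacian_ge[where f = "\<lambda>y. - f y" and s = s and x = x] assms
  by (simp add: laplacian_uminus algebra_simps)

lemma lip1_laplacian_bound:
  assumes "lip1 P f" shows "\<bar>\<Delta> f x\<bar> \<le> 1"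
proof -
  have "\<bar>P x y * (f y - f x)\<bar> \<le> P x y" for y
    using lip1_adjD[OF assms, of y x] P_eq_0[of x y] adj_commute[of x y] P_nonneg[of x y]
      mult_left_mono[of "\<bar>f y - f x\<bar>" 1 "P x y"]
    by (cases "x = y"; cases "adj P x y") (auto simp: abs_mult)
  then have "\<bar>\<Delta> f x\<bar> \<le> (\<Sum>y\<in>UNIV. P x y)"
    unfolding laplacian_def by (intro order_trans[OF sum_abs] sum_mono)
  then show ?thesis by (simp add: P_sum)
qed

section \<open>Inner boundaries and Lipschitz extensions\<close>

definition inner_bd :: "'a set \<Rightarrow> 'a set" where
  "inner_bd S = {x \<in> S. \<exists>y. y \<notin> S \<and> adj P x y}"

lemma inner_bd_nonempty:
  assumes "S \<noteq> {}" "S \<noteq> UNIV" shows "inner_bd S \<noteq> {}"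
proof
  assume *: "inner_bd S = {}"
  obtain x y where xy: "x \<in> S" "y \<notin> S" using assms by auto
  have "(adj P ^^ n) x z \<Longrightarrow> z \<in> S" for n z
  proof (induction n arbitrary: z)
    case (Suc n)
    then obtain v where "(adj P ^^ n) x v" "adj P v z" by (auto elim: relpowp_Suc_E)
    with Suc.IH[of v] * show ?case by (auto simp: inner_bd_def)
  qed (use xy in auto)
  then show False using xy by (metis dist_path)
qed

text \<open>The McShane extension: for nonempty \<open>K\<close>, the largest 1-Lipschitz function
  bounded by \<open>f\<close> on \<open>K\<close>. Applied to \<open>- f\<close> and negated, it
  gives the smallest one bounded below by \<open>f\<close> on \<open>K\<close>.\<close>

definition inf_ext :: "'a set \<Rightarrow> ('a \<Rightarrow> real) \<Rightarrow> 'a \<Rightarrow> real" where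
  "inf_ext K f x = Min ((\<lambda>k. f k + d k x) ` K)"

lemma inf_ext_le: "k \<in> K \<Longrightarrow> inf_ext K f x \<le> f k + d k x"
  unfolding inf_ext_def by (intro Min_le) auto

lemma inf_ext_attained:
  assumes "K \<noteq> {}" obtains k where "k \<in> K" "inf_ext K f x = f k + d k x"
proof -
  have "inf_ext K f x \<in> (\<lambda>k. f k + d k x) ` K"
    unfolding inf_ext_def using assms by (intro Min_in) auto
  with that show ?thesis by auto
qed

lemma inf_ext_lip1:
  assumes "K \<noteq> {}" shows "lip1 P (inf_ext K f)"
proof (rule lip1I)
  fix u v assume uv: "adj P u v"
  obtain k where k: "k \<in> K" "inf_ext K f v = f k + d k v" using assms by (rule inf_ext_attained)
  show "inf_ext K f u - inf_ext K f v \<le> 1"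
    using k inf_ext_le[of k K f u] dist_triangle[of k u v] dist_adj[OF uv] dist_commute[of u v] by auto
qed

lemma inf_ext_eq:
  assumes "lip1 P f" "k \<in> K" shows "inf_ext K f k = f k"
proof -
  obtain j where j: "j \<in> K" "inf_ext K f k = f j + d j k" using assms inf_ext_attained by blast
  then show ?thesis
    using inf_ext_le[of k K f k] lip1D[OF assms(1), of k j] assms(2) dist_self[of k] dist_commute[of k j] by auto
qed

section \<open>Boundary and energy\<close>

lemma ex_adj:
  assumes "CARD('a) \<ge> 2" shows "\<exists>x y. adj P x y"
proof -
  have "{undefined :: 'a} \<noteq> UNIV" using assms by (metis card_1_singleton_iff One_nat_def Suc_1 not_less_eq_eq order_refl)
  then have "inner_bd {undefined} \<noteq> {}" by (intro inner_bd_nonempty) auto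
  then show ?thesis by (auto simp: inner_bd_def)
qed

lemma P0_le:
  assumes "adj P x y" shows "P0 P \<le> P x y"
proof -
  have "P0 P \<le> P x y * (d x y)\<^sup>2"
    unfolding P0_def using assms P_nonneg by (intro cInf_lower bdd_belowI[of _ 0]) auto
  then show ?thesis by (simp add: dist_adj[OF assms])
qed

lemma P0_pos:
  assumes "CARD('a) \<ge> 2" shows "P0 P > 0"
proof -
  let ?A = "{P x y * (d x y)\<^sup>2 | x y. adj P x y}"
  have "?A \<subseteq> (\<lambda>(x, y). P x y * (d x y)\<^sup>2) ` UNIV" by auto
  then have "finite ?A" by (rule finite_subset) simp
  moreover have "?A \<noteq> {}" using ex_adj[OF assms] by auto
  ultimately have "Inf ?A \<in> ?A" by (metis (lifting) Min_in cInf_eq_Min)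
  then have "P0 P \<in> ?A" by (simp add: P0_def)
  then show ?thesis by (auto simp: dist_adj adj_def)
qed

text \<open>Detailed balance carries positive mass across every edge, and connectedness spreads it
  to all vertices.\<close>

lemma m_pos: "m x > 0"
proof -
  obtain y where y: "m y > 0"
    using m_sum m_nonneg by (metis less_eq_real_def sum.neutral zero_neq_one)
  have "(adj P ^^ n) y z \<Longrightarrow> m z > 0" for n z
  proof (induction n arbitrary: z)
    case (Suc n)
    then obtain v where v: "(adj P ^^ n) y v" "adj P v z" by (auto elim: relpowp_Suc_E)
    have "m v * P v z > 0" using Suc.IH[OF v(1)] v(2) by (auto simp: adj_def)
    then show ?case using m_P_commute[of v z] m_nonneg[of z] by (cases "m z = 0") auto
  qed (use y in auto)
  then show ?thesis by (metis dist_path)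
qed

lemma meas_UNIV: "meas m UNIV = 1"
  by (simp add: meas_def m_sum)

lemma meas_pos: "W \<noteq> {} \<Longrightarrow> meas m W > 0"
  unfolding meas_def by (intro sum_pos) (auto simp: m_pos)

lemma boundary_Compl: "boundary P m (- S) = boundary P m S"
proof -
  have "P x y * m x * d x y = P y x * m y * d y x" for x y
    using m_P_commute[of x y] dist_commute[of x y] by (simp add: mult.commute)
  then have "boundary P m (- S) = (\<Sum>x\<in>-S. \<Sum>y\<in>S. P y x * m y * d y x)"
    unfolding boundary_def by simp
  also have "\<dots> = boundary P m S" unfolding boundary_def by (rule sum.swap)
  finally show ?thesis .
qed

lemma edge_weight_nonneg: "P x y * m x * d x y \<ge> 0"
  by (simp add: P_nonneg m_nonneg dist_nonneg)

text \<open>Each vertex of the inner boundary has an edge of length one leaving \<open>S\<close>,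
  taken with probability at least \<open>P0 P\<close>.\<close>

lemma inner_bd_meas_le: "P0 P * meas m (inner_bd S) \<le> boundary P m S"
proof -
  have "P0 P * m x \<le> (\<Sum>y\<in>-S. P x y * m x * d x y)" if x: "x \<in> inner_bd S" for x
  proof -
    obtain y where y: "y \<in> - S" "adj P x y" using x by (auto simp: inner_bd_def)
    have "P0 P * m x \<le> P x y * m x * d x y"
      using P0_le[OF y(2)] dist_adj[OF y(2)] m_nonneg by (simp add: mult_right_mono)
    also have "\<dots> \<le> (\<Sum>y\<in>-S. P x y * m x * d x y)"
      using y edge_weight_nonneg by (intro member_le_sum) auto
    finally show ?thesis .
  qed
  then have "P0 P * meas m (inner_bd S) \<le> (\<Sum>x\<in>inner_bd S. \<Sum>y\<in>-S. P x y * m x * d x y)"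
    unfolding meas_def sum_distrib_left by (intro sum_mono)
  also have "\<dots> \<le> boundary P m S"
    unfolding boundary_def by (intro sum_mono2 sum_nonneg edge_weight_nonneg) (auto simp: inner_bd_def)
  finally show ?thesis .
qed

text \<open>The pairs leaving \<open>S\<close> give the flux. Inside \<open>S\<close>, detailed
  balance makes the weights symmetric, so averaging over both orders of \<open>x\<close> and
  \<open>y\<close> produces the Dirichlet form.\<close>

lemma Green_formula:
  "(\<Sum>x\<in>S. m x * \<phi> x * \<Delta> f x)
     = (\<Sum>x\<in>S. \<Sum>y\<in>-S. m x * P x y * \<phi> x * (f y - f x))
       - (\<Sum>x\<in>S. \<Sum>y\<in>S. m x * P x y * (\<phi> y - \<phi> x) * (f y - f x)) / 2"
proof -
  let ?I = "\<Sum>x\<in>S. \<Sum>y\<in>S. m x * P x y * \<phi> x * (f y - f x)"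
  have "?I = (\<Sum>x\<in>S. \<Sum>y\<in>S. m y * P y x * \<phi> y * (f x - f y))" by (rule sum.swap)
  also have "\<dots> = (\<Sum>x\<in>S. \<Sum>y\<in>S. m x * P x y * \<phi> y * (f x - f y))"
    by (simp only: m_P_commute)
  finally have "2 * ?I = ?I + (\<Sum>x\<in>S. \<Sum>y\<in>S. m x * P x y * \<phi> y * (f x - f y))" by simp
  also have "\<dots> = - (\<Sum>x\<in>S. \<Sum>y\<in>S. m x * P x y * (\<phi> y - \<phi> x) * (f y - f x))"
    unfolding sum.distrib[symmetric] sum_negf[symmetric] by (simp add: algebra_simps)
  finally have I: "?I = - (\<Sum>x\<in>S. \<Sum>y\<in>S. m x * P x y * (\<phi> y - \<phi> x) * (f y - f x)) / 2" by simp
  have "(\<Sum>x\<in>S. m x * \<phi> x * \<Delta> f x)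
      = (\<Sum>x\<in>S. (\<Sum>y\<in>-S. m x * P x y * \<phi> x * (f y - f x)) + (\<Sum>y\<in>S. m x * P x y * \<phi> x * (f y - f x)))"
  proof (rule sum.cong)
    fix x
    have "m x * \<phi> x * \<Delta> f x = (\<Sum>y\<in>UNIV. m x * P x y * \<phi> x * (f y - f x))"
      unfolding laplacian_def sum_distrib_left by (simp add: algebra_simps)
    also have "\<dots> = (\<Sum>y\<in>-S. m x * P x y * \<phi> x * (f y - f x)) + (\<Sum>y\<in>S. m x * P x y * \<phi> x * (f y - f x))"
      using sum.subset_diff[of S UNIV "\<lambda>y. m x * P x y * \<phi> x * (f y - f x)"]
      by (simp add: Compl_eq_Diff_UNIV)
    finally show "m x * \<phi> x * \<Delta> f x
      = (\<Sum>y\<in>-S. m x * P x y * \<phi> x * (f y - f x)) + (\<Sum>y\<in>S. m x * P x y * \<phi> x * (f y - f x))" .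
  qed simp
  then show ?thesis unfolding sum.distrib using I by simp
qed

text \<open>Green's formula for a test function increasing in \<open>f\<close>. The flux costs at
  most \<open>B\<close> times the boundary and the Laplacian bound costs the term with
  \<open>c\<close>; the Dirichlet form is at least the contribution of one upward edge per vertex of
  \<open>G\<close>.\<close>

lemma energy_bound:
  assumes f: "lip1 P f" and mono: "\<And>x y. f x \<le> f y \<Longrightarrow> \<phi> x \<le> \<phi> y"
    and \<phi>: "\<And>x. 0 \<le> \<phi> x" "\<And>x. \<phi> x \<le> B"
    and lap: "\<And>x. x \<in> S \<Longrightarrow> \<Delta> f x \<ge> - c"
    and G: "G \<subseteq> S"
    and up: "\<And>x. x \<in> G \<Longrightarrow> \<exists>z\<in>S. adj P x z \<and> f z = f x + 1 \<and> \<phi> z \<ge> \<phi> x + \<psi> x"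
    and P0: "P0 P > 0"
  shows "P0 P * (\<Sum>x\<in>G. m x * \<psi> x) \<le> B * boundary P m S + c * (\<Sum>x\<in>S. m x * \<phi> x)"
proof -
  define t where "t x y = m x * P x y * (\<phi> y - \<phi> x) * (f y - f x)" for x y
  \<comment> \<open>Keeping only the direction in which \<open>f\<close> increases counts each edge
    once, which absorbs the factor 1/2 in Green's formula.\<close>
  define t' where "t' x y = (if f x < f y then t x y else 0)" for x y
  have t_nonneg: "t x y \<ge> 0" for x y
    using mono[of x y] mono[of y x] m_nonneg[of x] P_nonneg[of x y]
    by (cases "f x \<le> f y") (auto simp: t_def mult.assoc zero_le_mult_iff)
  have t_sym: "t x y = t y x" for x y
    unfolding t_def m_P_commute[of x y] by (simp add: algebra_simps)
  have "2 * (\<Sum>x\<in>S. \<Sum>y\<in>S. t' x y) = (\<Sum>x\<in>S. \<Sum>y\<in>S. t' x y + t' y x)"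
    unfolding sum.distrib by (subst (3) sum.swap) simp
  also have "\<dots> \<le> (\<Sum>x\<in>S. \<Sum>y\<in>S. t x y)"
    using t_nonneg t_sym by (intro sum_mono) (auto simp: t'_def)
  finally have E: "(\<Sum>x\<in>S. \<Sum>y\<in>S. t' x y) \<le> (\<Sum>x\<in>S. \<Sum>y\<in>S. t x y) / 2" by simp
  have "P0 P * (m x * \<psi> x) \<le> (\<Sum>y\<in>S. t' x y)" if x: "x \<in> G" for x
  proof -
    obtain z where z: "z \<in> S" "adj P x z" "f z = f x + 1" "\<phi> z \<ge> \<phi> x + \<psi> x"
      using up[OF x] by auto
    have "P0 P * (m x * \<psi> x) \<le> P0 P * (m x * (\<phi> z - \<phi> x))"
      using P0 m_nonneg[of x] z(4) by (intro mult_left_mono) auto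
    also have "\<dots> \<le> P x z * (m x * (\<phi> z - \<phi> x))"
      using P0_le[OF z(2)] m_nonneg[of x] mono[of x z] z(3) by (intro mult_right_mono) auto
    also have "\<dots> = t' x z" using z(3) by (simp add: t'_def t_def algebra_simps)
    also have "\<dots> \<le> (\<Sum>y\<in>S. t' x y)"
      using z(1) t_nonneg by (intro member_le_sum) (auto simp: t'_def)
    finally show ?thesis .
  qed
  then have "P0 P * (\<Sum>x\<in>G. m x * \<psi> x) \<le> (\<Sum>x\<in>G. \<Sum>y\<in>S. t' x y)"
    unfolding sum_distrib_left by (intro sum_mono)
  also have "\<dots> \<le> (\<Sum>x\<in>S. \<Sum>y\<in>S. t' x y)"
    using G t_nonneg by (intro sum_mono2 sum_nonneg) (auto simp: t'_def)
  also note E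
  also have "(\<Sum>x\<in>S. \<Sum>y\<in>S. t x y) / 2 = (\<Sum>x\<in>S. \<Sum>y\<in>-S. m x * P x y * \<phi> x * (f y - f x))
      - (\<Sum>x\<in>S. m x * \<phi> x * \<Delta> f x)"
    unfolding Green_formula t_def by simp
  also have "\<dots> \<le> B * boundary P m S + c * (\<Sum>x\<in>S. m x * \<phi> x)"
  proof -
    have "m x * P x y * \<phi> x * (f y - f x) \<le> B * (P x y * m x * d x y)" for x y
    proof -
      have "\<phi> x * (f y - f x) \<le> \<phi> x * d x y"
        using \<phi>(1) lip1D[OF f, of y x] dist_commute[of x y] by (intro mult_left_mono) auto
      also have "\<dots> \<le> B * d x y" using \<phi>(2) dist_nonneg by (intro mult_right_mono)
      finally have "m x * P x y * (\<phi> x * (f y - f x)) \<le> m x * P x y * (B * d x y)"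
        using m_nonneg P_nonneg by (intro mult_left_mono) auto
      then show ?thesis by (simp add: algebra_simps)
    qed
    then have "(\<Sum>x\<in>S. \<Sum>y\<in>-S. m x * P x y * \<phi> x * (f y - f x)) \<le> B * boundary P m S"
      unfolding boundary_def sum_distrib_left by (intro sum_mono)
    moreover have "(\<Sum>x\<in>S. - c * (m x * \<phi> x)) \<le> (\<Sum>x\<in>S. m x * \<phi> x * \<Delta> f x)"
    proof (intro sum_mono)
      fix x assume "x \<in> S"
      then have "m x * \<phi> x * - c \<le> m x * \<phi> x * \<Delta> f x"
        using lap m_nonneg \<phi> by (intro mult_left_mono) auto
      then show "- c * (m x * \<phi> x) \<le> m x * \<phi> x * \<Delta> f x" by (simp add: algebra_simps)
    qed
    ultimately show ?thesis unfolding sum_distrib_left[symmetric] by simp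
  qed
  finally show ?thesis .
qed

lemma ex_median:
  obtains a where "meas m {x. f x \<le> (a::real)} \<ge> 1/2" "meas m {x. a \<le> f x} \<ge> 1/2"
proof -
  \<comment> \<open>The median is the least value of \<open>f\<close> whose sublevel set has mass at
    least 1/2.\<close>
  define A where "A = {t \<in> range f. meas m {x. f x \<le> t} \<ge> 1/2}"
  have "finite A" by (simp add: A_def)
  have "{x. f x \<le> Max (range f)} = UNIV" by auto
  then have "Max (range f) \<in> A" by (simp add: A_def meas_UNIV)
  then have "A \<noteq> {}" by auto
  then have a: "Min A \<in> A" using \<open>finite A\<close> by simp
  have "meas m {x. f x < Min A} < 1/2"
  proof (rule ccontr)
    assume *: "\<not> ?thesis"
    \<comment> \<open>Otherwise \<open>Max T\<close>, the next smaller value of \<open>f\<close>,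
      would already lie in \<open>A\<close>.\<close>
    define T where "T = f ` {x. f x < Min A}"
    have "T \<noteq> {}"
    proof
      assume "T = {}"
      then have "{x. f x < Min A} = {}" by (auto simp: T_def)
      with * show False by (simp add: meas_def)
    qed
    then have T: "Max T \<in> T" by (simp add: T_def)
    have "{x. f x < Min A} \<subseteq> {x. f x \<le> Max T}" by (auto simp: T_def)
    with * meas_mono[of m, OF m_nonneg this] have "Max T \<in> A" using T by (auto simp: A_def T_def)
    then have "Min A \<le> Max T" using \<open>finite A\<close> by simp
    with T show False by (auto simp: T_def)
  qed
  moreover have "{x. Min A \<le> f x} = - {x. f x < Min A}" by auto
  ultimately have "meas m {x. Min A \<le> f x} \<ge> 1/2" by (simp add: meas_Compl m_sum)
  with a that show ?thesis by (auto simp: A_def)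
qed

end

section \<open>Laplacian separation\<close>

locale nonneg_curved_chain = reversible_chain +
  assumes curvature: "adj P x y \<Longrightarrow> ollivier_curvature P x y \<ge> 0"
begin

text \<open>\<open>g\<close> itself competes in the infimum that defines the curvature.\<close>

lemma laplacian_antimono:
  assumes "lip1 P g" "adj P x y" "g y - g x = 1" shows "\<Delta> g y \<le> \<Delta> g x"
proof -
  let ?A = "{(\<Delta> f x - \<Delta> f y) / d x y | f. lip1 P f \<and> f y - f x = d x y}"
  have d1: "d x y = 1" using assms(2) by (rule dist_adj)
  \<comment> \<open>A real \<open>Inf\<close> is known to be a lower bound only if the set is
    bounded below; here both Laplacians lie in [-1, 1].\<close>
  have "bdd_below ?A"
  proof (rule bdd_belowI[of _ "-2"])
    fix t assume "t \<in> ?A"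
    then obtain f where "t = \<Delta> f x - \<Delta> f y" "lip1 P f" by (auto simp: d1)
    then show "- 2 \<le> t" using lip1_laplacian_bound[of f x] lip1_laplacian_bound[of f y] by linarith
  qed
  moreover have "\<Delta> g x - \<Delta> g y \<in> ?A" using assms d1 by auto
  ultimately have "Inf ?A \<le> \<Delta> g x - \<Delta> g y" by (intro cInf_lower)
  with curvature[OF assms(2)] show ?thesis by (simp add: ollivier_curvature_def)
qed

text \<open>If the slope of \<open>f\<close> along an edge falls short of one by \<open>s\<close>,
  curvature lets \<open>\<Delta> f\<close> increase along it by at most \<open>2 * s\<close>, and
  the factor 1/2 matches this to the deficit.\<close>

lemma half_heat_step_lip1:
  assumes f: "lip1 P f" shows "lip1 P (\<lambda>x. f x + \<Delta> f x / 2)"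
proof (rule lip1I)
  fix y x assume yx: "adj P y x"
  then have xy: "adj P x y" by (simp add: adj_commute)
  define s where "s = 1 - (f y - f x)"
  \<comment> \<open>the least 1-Lipschitz majorant of \<open>f\<close> with full slope along the edge; it exceeds \<open>f\<close> by at most \<open>s\<close>\<close>
  define g where "g u = max (f u) (f x + 1 - d u y)" for u
  have s: "s \<ge> 0" "f y - f x = 1 - s" using lip1_adjD[OF f yx] by (auto simp: s_def)
  have g: "lip1 P g"
  proof (rule lip1I)
    fix u v assume uv: "adj P u v"
    show "g u - g v \<le> 1"
      using lip1_adjD[OF f uv] dist_triangle[of v y u] dist_adj[OF uv] dist_commute[of u v]
      by (auto simp: g_def)
  qed
  have gy: "g y = f y + s" using s by (auto simp: g_def dist_self)
  have gx: "g x = f x" using dist_adj[OF xy] by (auto simp: g_def)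
  have h: "0 \<le> g u - f u \<and> g u - f u \<le> s" for u
    using lip1D[OF f, of y u] dist_commute[of u y] s by (auto simp: g_def)
  have "\<Delta> g y \<le> \<Delta> g x"
    using laplacian_antimono[OF g xy] gx gy s by auto
  moreover have "\<Delta> (\<lambda>u. g u - f u) y \<ge> - s"
    using h gy by (intro laplacian_ge) (smt (verit))
  moreover have "\<Delta> (\<lambda>u. g u - f u) x \<le> s"
    using h gx by (intro laplacian_le) (smt (verit))
  ultimately show "f y + \<Delta> f y / 2 - (f x + \<Delta> f x / 2) \<le> 1"
    using s by (simp add: laplacian_diff)
qed

text \<open>Walk from \<open>x\<close> back to \<open>k\<close> along a geodesic. The bound
  \<open>le\<close> and the Lipschitz property preserve the equality
  \<open>g x = f k + d k x\<close>, so \<open>g\<close> drops by one per step and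
  \<open>\<Delta> g\<close> never decreases. The walk cannot leave \<open>W\<close> before meeting
  \<open>K\<close>, where \<open>C\<close> is a bound.\<close>

lemma laplacian_inf_ext_le:
  assumes g: "lip1 P g" and "g x = f k + d k x" "x \<in> W" "k \<in> K"
    and le: "\<And>y. y \<in> W \<Longrightarrow> g y \<le> f k + d k y"
    and "inner_bd W \<subseteq> K" and C: "\<And>k. k \<in> K \<Longrightarrow> \<Delta> g k \<le> C"
  shows "\<Delta> g x \<le> C"
proof -
  obtain n where "d k x = real n" by (rule dist_path)
  then show ?thesis using assms(2,3)
  proof (induction n arbitrary: x)
    case 0
    then show ?case using dist_eq_0 assms(4) C by auto
  next
    case (Suc n)
    show ?case
    proof (cases "x \<in> K")
      case False
      have "x \<noteq> k" using Suc.prems dist_eq_0[of k x] by auto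
      then obtain z where z: "adj P x z" "d k x = d k z + 1" by (rule dist_step)
      have "z \<in> W" using z(1) False Suc.prems assms(6) by (auto simp: inner_bd_def)
      with z le[of z] Suc.prems lip1_adjD[OF g z(1)]
      have gz: "g z = f k + d k z" "g x - g z = 1" by auto
      have "\<Delta> g x \<le> \<Delta> g z" using laplacian_antimono[OF g _ gz(2)] z(1) adj_commute by auto
      also have "\<dots> \<le> C" using Suc.IH[of z] z gz \<open>z \<in> W\<close> Suc.prems by auto
      finally show ?thesis .
    qed (rule C)
  qed
qed

lemma laplacian_separation:
  assumes "W \<noteq> {}" "W \<noteq> UNIV"
  obtains g C where "lip1 P g"
    "\<And>x. x \<in> W \<Longrightarrow> \<Delta> g x \<le> C" "\<And>x. x \<notin> W \<Longrightarrow> \<Delta> g x \<ge> C"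
    "\<And>x. x \<in> W \<Longrightarrow> x \<notin> inner_bd W \<Longrightarrow> \<exists>z. adj P x z \<and> g z = g x - 1"
    "\<And>x. x \<notin> W \<Longrightarrow> \<exists>z. adj P x z \<and> g z = g x + 1"
proof -
  define K where "K = inner_bd W"
  have K: "K \<noteq> {}" "K \<subseteq> W" using inner_bd_nonempty[OF assms] by (auto simp: K_def inner_bd_def)
  then obtain k0 where k0: "k0 \<in> K" by auto
  define ext where "ext f x = (if x \<in> W then inf_ext K f x else - inf_ext K (\<lambda>y. - f y) x)"
    for f x
  have ext_lip: "lip1 P (ext f)" if f: "lip1 P f" for f
  proof -
    \<comment> \<open>Both branches equal \<open>f\<close> on \<open>K\<close>, so the outer formula
      also holds there. Every edge not inside \<open>W\<close> has both ends where it holds.\<close>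
    have out: "ext f x = - inf_ext K (\<lambda>y. - f y) x" if "x \<in> K \<or> x \<notin> W" for x
      using that inf_ext_eq[OF f, of x K] inf_ext_eq[OF lip1_uminus[OF f], of x K]
      by (auto simp: ext_def)
    have "\<bar>ext f u - ext f v\<bar> \<le> 1" if uv: "adj P u v" for u v
    proof (cases "u \<in> W \<and> v \<in> W")
      case True
      then show ?thesis using lip1_adjD[OF inf_ext_lip1[OF K(1), of f] uv] by (simp add: ext_def)
    next
      case False
      then have "u \<in> K \<or> u \<notin> W" "v \<in> K \<or> v \<notin> W"
        using uv adj_commute by (auto simp: K_def inner_bd_def)
      then show ?thesis
        using lip1_adjD[OF inf_ext_lip1[OF K(1), of "\<lambda>y. - f y"] uv] by (simp add: out)
    qed
    then show ?thesis by (intro lip1I) (meson abs_le_D1)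
  qed
  define T where "T f x = ext f x + \<Delta> (ext f) x / 2" for f x
  \<comment> \<open>Fixing the value at \<open>k0\<close> removes the additive constants, which
    makes the set compact.\<close>
  define S where "S = {v :: real^'a. v $ k0 = 0 \<and> lip1 P (($) v)}"
  define \<Phi> where "\<Phi> v = (\<chi> x. T (($) v) x - T (($) v) k0)" for v :: "real^'a"
  have T_lip: "lip1 P (T f)" if "lip1 P f" for f
    using half_heat_step_lip1[OF ext_lip[OF that]] by (simp add: T_def[abs_def])
  have cont_inf: "continuous_on UNIV (\<lambda>v::real^'a. inf_ext K (\<lambda>y. c * v $ y) x)" for x c
    unfolding inf_ext_def using K by (intro continuous_on_Min_image continuous_intros) auto
  have cont_ext: "continuous_on UNIV (\<lambda>v::real^'a. ext (($) v) x)" for x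
    using cont_inf[of 1 x] continuous_on_minus[OF cont_inf[of "-1" x]]
    by (cases "x \<in> W") (simp_all add: ext_def)
  have "continuous_on UNIV \<Phi>"
    unfolding \<Phi>_def T_def laplacian_def
    by (intro continuous_on_vec_lambda continuous_intros cont_ext) auto
  then have cont: "continuous_on S \<Phi>" by (rule continuous_on_subset) auto
  have "closed S"
    unfolding S_def lip1_def by (intro closed_Collect_conj closed_Collect_all closed_Collect_eq
      closed_Collect_le continuous_intros)
  moreover have "bounded S"
  proof -
    have "norm v \<le> (\<Sum>i\<in>UNIV. d i k0)" if "v \<in> S" for v
    proof -
      have "\<bar>v $ i\<bar> \<le> d i k0" for i using that unfolding S_def lip1_def
        by (metis (mono_tags, lifting) diff_zero mem_Collect_eq)
      then show ?thesis by (intro order_trans[OF norm_le_l1_cart] sum_mono)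
    qed
    then show ?thesis by (auto simp: bounded_iff)
  qed
  ultimately have "compact S" by (simp add: compact_eq_bounded_closed)
  moreover have "convex S"
  proof (rule convexI)
    fix v w :: "real^'a" and a b :: real
    assume *: "v \<in> S" "w \<in> S" "0 \<le> a" "0 \<le> b" "a + b = 1"
    have "\<bar>(a *\<^sub>R v + b *\<^sub>R w) $ i - (a *\<^sub>R v + b *\<^sub>R w) $ j\<bar> \<le> d i j" for i j
    proof -
      have "\<bar>(a *\<^sub>R v + b *\<^sub>R w) $ i - (a *\<^sub>R v + b *\<^sub>R w) $ j\<bar>
          = \<bar>a * (v $ i - v $ j) + b * (w $ i - w $ j)\<bar>" by (simp add: algebra_simps)
      also have "\<dots> \<le> a * \<bar>v $ i - v $ j\<bar> + b * \<bar>w $ i - w $ j\<bar>"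
        using * by (intro order_trans[OF abs_triangle_ineq]) (simp add: abs_mult)
      also have "\<dots> \<le> a * d i j + b * d i j"
        using * by (intro add_mono mult_left_mono) (auto simp: S_def lip1_def)
      also have "\<dots> = d i j" using * by (simp add: distrib_right[symmetric])
      finally show ?thesis .
    qed
    then show "a *\<^sub>R v + b *\<^sub>R w \<in> S" using * by (auto simp: S_def lip1_def)
  qed
  moreover have "S \<noteq> {}"
  proof -
    have "0 \<in> S" by (auto simp: S_def lip1_def dist_nonneg)
    then show ?thesis by auto
  qed
  moreover have "\<Phi> \<in> S \<rightarrow> S"
  proof
    fix v assume "v \<in> S"
    then have "lip1 P (T (($) v))" using T_lip by (auto simp: S_def)
    then show "\<Phi> v \<in> S" by (auto simp: S_def \<Phi>_def lip1_def)
  qed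
  ultimately obtain v where v: "v \<in> S" "\<Phi> v = v" using brouwer cont by metis
  define f where "f = ($) v"
  define g where "g = ext f"
  \<comment> \<open>At a fixed point \<open>f\<close> is \<open>T f\<close> minus the constant
    \<open>T f k0\<close>. As \<open>ext f\<close> equals \<open>f\<close> on \<open>K\<close>, this
    leaves \<open>\<Delta> g k / 2 = T f k0\<close> there.\<close>
  define C where "C = 2 * T f k0"
  have f: "lip1 P f" using v by (simp add: S_def f_def)
  have g: "lip1 P g" unfolding g_def by (rule ext_lip[OF f])
  have gK: "g k = f k" if "k \<in> K" for k
    using that K inf_ext_eq[OF f] by (auto simp: g_def ext_def)
  have lapK: "\<Delta> g k = C" if "k \<in> K" for k
  proof -
    have "f k = \<Phi> v $ k" by (simp add: v(2) f_def)
    also have "\<dots> = f k + \<Delta> g k / 2 - C / 2"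
      using gK[OF that] by (simp add: \<Phi>_def T_def C_def g_def f_def field_simps)
    finally show ?thesis by simp
  qed
  \<comment> \<open>The outside is treated through \<open>- g\<close>, a largest extension on
    \<open>- (W - K)\<close>. The set \<open>K\<close> is included because the inner boundary of
    \<open>- W\<close> alone would not lie in \<open>K\<close>.\<close>
  define h where "h y = - g y" for y
  have h: "lip1 P h" unfolding h_def using g by (rule lip1_uminus)
  have lap_h: "\<Delta> h x = - \<Delta> g x" for x unfolding h_def by (rule laplacian_uminus)
  have gW: "g y = inf_ext K f y" if "y \<in> W" for y
    using that by (simp add: g_def ext_def)
  have hX: "h y = inf_ext K (\<lambda>y. - f y) y" if "y \<in> - (W - K)" for y
    using that gK[of y] inf_ext_eq[OF lip1_uminus[OF f], of y K] by (auto simp: h_def g_def ext_def)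
  have bd: "inner_bd (- (W - K)) \<subseteq> K"
    using adj_commute by (auto simp: K_def inner_bd_def)
  show ?thesis
  proof
    show "lip1 P g" by (rule g)
  next
    fix x assume x: "x \<in> W"
    obtain k where k: "k \<in> K" "inf_ext K f x = f k + d k x" using K(1) by (rule inf_ext_attained)
    show "\<Delta> g x \<le> C"
      by (rule laplacian_inf_ext_le[OF g _ x k(1), where f = f])
        (use k x inf_ext_le[of k K f] gW lapK in \<open>auto simp: K_def\<close>)
    assume "x \<notin> inner_bd W"
    then have "x \<notin> K" by (simp add: K_def)
    with k have "x \<noteq> k" by auto
    then obtain z where z: "adj P x z" "d k x = d k z + 1" by (rule dist_step)
    have "z \<in> W" using z(1) x \<open>x \<notin> K\<close> by (auto simp: K_def inner_bd_def)
    with z k x gW[of x] gW[of z] inf_ext_le[of k K f z] lip1_adjD[OF g z(1)]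
    show "\<exists>z. adj P x z \<and> g z = g x - 1" by (intro exI[of _ z]) auto
  next
    fix x assume x: "x \<notin> W"
    let ?f = "\<lambda>y. - f y"
    obtain k where k: "k \<in> K" "inf_ext K ?f x = - f k + d k x" using K(1) inf_ext_attained by blast
    have "\<Delta> h x \<le> - C"
      by (rule laplacian_inf_ext_le[OF h _ _ k(1), where f = ?f and W = "- (W - K)"])
        (use k x inf_ext_le[of k K ?f] hX lapK bd in \<open>auto simp: lap_h\<close>)
    then show "\<Delta> g x \<ge> C" by (simp add: lap_h)
    have "x \<noteq> k" using x k K by auto
    then obtain z where z: "adj P x z" "d k x = d k z + 1" by (rule dist_step)
    have "z \<in> - (W - K)" using z(1) x adj_commute by (auto simp: K_def inner_bd_def)
    with z k x hX[of x] hX[of z] inf_ext_le[of k K ?f z] lip1_adjD[OF h z(1)]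
    show "\<exists>z. adj P x z \<and> g z = g x + 1" by (intro exI[of _ z]) (auto simp: h_def)
  qed
qed

end

section \<open>Isoperimetry from concentration\<close>

locale concentrated_chain = nonneg_curved_chain +
  fixes \<rho> :: real
  assumes card: "CARD('a) \<ge> 2" and \<rho>: "\<rho> > 0"
    and conc: "meas m A \<ge> 1/2 \<Longrightarrow> r > 0 \<Longrightarrow> meas m (- nbhd P A r) \<le> exp (- \<rho> * r\<^sup>2)"
begin

lemma P0_gt_0: "P0 P > 0"
  by (rule P0_pos[OF card])

text \<open>Where \<open>f\<close> exceeds \<open>a + r\<close>, the distance to the sublevel set of
  \<open>a\<close> exceeds \<open>r\<close>.\<close>

lemma upper_tail:
  assumes "lip1 P f" "meas m {x. f x \<le> a} \<ge> 1/2" "r > 0"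
  shows "meas m {x. f x > a + r} \<le> exp (- \<rho> * r\<^sup>2)"
proof -
  have "{x. f x > a + r} \<subseteq> - nbhd P {x. f x \<le> a} r"
  proof
    fix x assume x: "x \<in> {x. f x > a + r}"
    have False if "f y \<le> a" "d x y \<le> r" for y
      using lip1D[OF assms(1), of x y] that x by auto
    then show "x \<in> - nbhd P {x. f x \<le> a} r" by (auto simp: nbhd_def)
  qed
  then show ?thesis using conc[OF assms(2,3)] meas_mono[of m, OF m_nonneg] by (meson order_trans)
qed

lemma lower_tail:
  assumes "lip1 P f" "meas m {x. a \<le> f x} \<ge> 1/2" "r > 0"
  shows "meas m {x. f x < a - r} \<le> exp (- \<rho> * r\<^sup>2)"
  using upper_tail[OF lip1_uminus[OF assms(1)], of "-a" r] assms(2,3)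
  by (simp add: less_minus_iff algebra_simps)

text \<open>The energy bound with a truncation of \<open>f\<close> and \<open>c = 0\<close> controls
  the mass of \<open>S\<close> off its inner boundary and the two tails. The inner boundary raises
  the factor from \<open>2 * R + 1\<close> to \<open>2 * R + 2\<close>.\<close>

lemma boundary_ge_of_subharmonic:
  assumes f: "lip1 P f" and lap: "\<And>x. x \<in> S \<Longrightarrow> \<Delta> f x \<ge> 0"
    and up: "\<And>x. x \<in> S \<Longrightarrow> x \<notin> inner_bd S \<Longrightarrow> \<exists>z. adj P x z \<and> f z = f x + 1"
    and R: "R > 0"
  shows "P0 P * (meas m S - 2 * exp (- \<rho> * R\<^sup>2)) \<le> (2 * R + 2) * boundary P m S"
proof -
  obtain a where a: "meas m {x. f x \<le> a} \<ge> 1/2" "meas m {x. a \<le> f x} \<ge> 1/2" by (rule ex_median)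
  \<comment> \<open>The upper cut is at \<open>a + R + 1\<close>, so that a step up from level
    \<open>a + R\<close> still gains a full unit.\<close>
  define \<phi> where "\<phi> x = max 0 (min (f x - (a - R)) (2 * R + 1))" for x
  define G where "G = {x \<in> S - inner_bd S. a - R \<le> f x \<and> f x \<le> a + R}"
  have "P0 P * (\<Sum>x\<in>G. m x * 1) \<le> (2 * R + 1) * boundary P m S + 0 * (\<Sum>x\<in>S. m x * \<phi> x)"
  proof (rule energy_bound[OF f])
    fix x assume x: "x \<in> G"
    then obtain z where z: "adj P x z" "f z = f x + 1" using up by (auto simp: G_def)
    moreover have "z \<in> S" using x z(1) by (auto simp: G_def inner_bd_def)
    moreover have "\<phi> z \<ge> \<phi> x + 1" using x z(2) by (auto simp: G_def \<phi>_def)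
    ultimately show "\<exists>z\<in>S. adj P x z \<and> f z = f x + 1 \<and> \<phi> x + 1 \<le> \<phi> z" by auto
  qed (use R lap P0_gt_0 in \<open>auto simp: \<phi>_def G_def\<close>)
  then have 1: "P0 P * meas m G \<le> (2 * R + 1) * boundary P m S" by (simp add: meas_def)
  have "S \<subseteq> (G \<union> inner_bd S) \<union> ({x. f x > a + R} \<union> {x. f x < a - R})"
    by (auto simp: G_def)
  then have "meas m S \<le> meas m ((G \<union> inner_bd S) \<union> ({x. f x > a + R} \<union> {x. f x < a - R}))"
    by (intro meas_mono m_nonneg)
  also have "\<dots> \<le> (meas m G + meas m (inner_bd S)) + (meas m {x. f x > a + R} + meas m {x. f x < a - R})"
    by (intro order_trans[OF meas_Un_le] add_mono meas_Un_le m_nonneg)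
  also have "\<dots> \<le> meas m G + meas m (inner_bd S) + 2 * exp (- \<rho> * R\<^sup>2)"
    using upper_tail[OF f a(1) R] lower_tail[OF f a(2) R] by simp
  finally have "P0 P * (meas m S - 2 * exp (- \<rho> * R\<^sup>2)) \<le> P0 P * (meas m G + meas m (inner_bd S))"
    using P0_gt_0 by (intro mult_left_mono) auto
  with 1 inner_bd_meas_le[of S] show ?thesis by (simp add: algebra_simps)
qed

lemma meas_le_exp_of_small_boundary:
  assumes f: "lip1 P f" and lap: "\<And>x. x \<in> S \<Longrightarrow> \<Delta> f x \<ge> - (P0 P * q)"
    and up: "\<And>x. x \<in> S \<Longrightarrow> x \<notin> inner_bd S \<Longrightarrow> \<exists>z. adj P x z \<and> f z = f x + 1"
    and R: "R > 0" and q: "q > 0" and bd: "boundary P m S \<le> P0 P * q * w"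
  shows "1/2 - meas m (- S) - q * w - exp (- \<rho> * R\<^sup>2)
           \<le> exp (2 * q * (R + 1)) * (w + q * w + exp (- \<rho> * R\<^sup>2))"
proof -
  obtain a where a: "meas m {x. f x \<le> a} \<ge> 1/2" "meas m {x. a \<le> f x} \<ge> 1/2" by (rule ex_median)
  \<comment> \<open>A step up multiplies the test function by \<open>1 + 2 * q\<close>, so its gain
    is twice the loss \<open>q * \<phi> x\<close> allowed by the Laplacian bound.\<close>
  define l where "l = ln (1 + 2 * q)"
  have l: "l > 0" "exp l = 1 + 2 * q" "l \<le> 2 * q"
    using q ln_add_one_self_le_self[of "2 * q"] by (auto simp: l_def)
  define b where "b = a + R + 1"
  define \<phi> where "\<phi> x = exp (l * min (f x) b)" for x
  define B where "B = exp (l * b)"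
  define G where "G = {x \<in> S - inner_bd S. f x \<le> a + R}"
  define T where "T = {x. f x > a + R}"
  have T: "meas m T \<le> exp (- \<rho> * R\<^sup>2)" unfolding T_def by (rule upper_tail[OF f a(1) R])
  have "P0 P * meas m (inner_bd S) \<le> P0 P * (q * w)"
    using inner_bd_meas_le[of S] bd by (simp add: mult.assoc)
  then have inner: "meas m (inner_bd S) \<le> q * w" using P0_gt_0 by simp
  have \<phi>B: "\<phi> x \<le> B" for x using l(1) by (simp add: \<phi>_def B_def)
  have "P0 P * (\<Sum>x\<in>G. m x * (2 * q * \<phi> x)) \<le> B * boundary P m S + P0 P * q * (\<Sum>x\<in>S. m x * \<phi> x)"
  proof (rule energy_bound[OF f])
    fix x assume x: "x \<in> G"
    then obtain z where z: "adj P x z" "f z = f x + 1" using up by (auto simp: G_def)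
    moreover have "z \<in> S" using x z(1) by (auto simp: G_def inner_bd_def)
    moreover have "\<phi> z = exp l * \<phi> x" using x z(2)
      by (simp add: G_def \<phi>_def b_def exp_add[symmetric] algebra_simps)
    ultimately show "\<exists>z\<in>S. adj P x z \<and> f z = f x + 1 \<and> \<phi> x + 2 * q * \<phi> x \<le> \<phi> z"
      by (auto simp: l(2) algebra_simps)
  qed (use \<phi>B lap P0_gt_0 l(1) in \<open>auto simp: \<phi>_def G_def\<close>)
  also have "\<dots> \<le> B * (P0 P * q * w) + P0 P * q * (\<Sum>x\<in>S. m x * \<phi> x)"
    using bd by (simp add: B_def)
  finally have "(P0 P * q) * (2 * (\<Sum>x\<in>G. m x * \<phi> x)) \<le> (P0 P * q) * (B * w + (\<Sum>x\<in>S. m x * \<phi> x))"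
    by (simp add: sum_distrib_left algebra_simps)
  then have 1: "2 * (\<Sum>x\<in>G. m x * \<phi> x) \<le> B * w + (\<Sum>x\<in>S. m x * \<phi> x)"
    using P0_gt_0 q by (simp add: zero_less_mult_iff)
  \<comment> \<open>One of the two copies of the sum over \<open>G\<close> is absorbed; the rest of
    \<open>S\<close> lies in the inner boundary or the upper tail.\<close>
  have "(\<Sum>x\<in>S. m x * \<phi> x) = (\<Sum>x\<in>G. m x * \<phi> x) + (\<Sum>x\<in>S - G. m x * \<phi> x)"
    using sum.subset_diff[of G S "\<lambda>x. m x * \<phi> x"] by (simp add: G_def)
  also have "(\<Sum>x\<in>S - G. m x * \<phi> x) \<le> (\<Sum>x\<in>S - G. m x * B)"
    using \<phi>B m_nonneg by (intro sum_mono mult_left_mono)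
  also have "\<dots> = B * meas m (S - G)" by (simp add: meas_def sum_distrib_left mult.commute)
  also have "meas m (S - G) \<le> meas m (inner_bd S \<union> T)"
    by (intro meas_mono m_nonneg) (auto simp: G_def T_def)
  also have "\<dots> \<le> q * w + exp (- \<rho> * R\<^sup>2)"
    using inner T by (intro order_trans[OF meas_Un_le] m_nonneg add_mono)
  finally have 2: "(\<Sum>x\<in>G. m x * \<phi> x) \<le> B * (w + q * w + exp (- \<rho> * R\<^sup>2))"
    using 1 by (simp add: B_def algebra_simps)
  \<comment> \<open>The half of the mass above the median lies in \<open>G\<close> up to small sets,
    and there the test function is at least \<open>exp (l * a)\<close>. Against \<open>B\<close>
    only the factor \<open>exp (l * (R + 1))\<close> remains.\<close>
  let ?H = "{x \<in> G. a \<le> f x}"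
  have "{x. a \<le> f x} \<subseteq> (?H \<union> - S) \<union> (inner_bd S \<union> T)" by (auto simp: G_def T_def)
  then have "meas m {x. a \<le> f x} \<le> meas m ((?H \<union> - S) \<union> (inner_bd S \<union> T))"
    by (intro meas_mono m_nonneg)
  also have "\<dots> \<le> (meas m ?H + meas m (- S)) + (meas m (inner_bd S) + meas m T)"
    by (intro order_trans[OF meas_Un_le] add_mono meas_Un_le m_nonneg)
  finally have "1/2 - meas m (- S) - q * w - exp (- \<rho> * R\<^sup>2) \<le> meas m ?H"
    using a(2) inner T by simp
  then have "exp (l * a) * (1/2 - meas m (- S) - q * w - exp (- \<rho> * R\<^sup>2)) \<le> exp (l * a) * meas m ?H"
    by (intro mult_left_mono) auto
  also have "\<dots> = (\<Sum>x\<in>?H. m x * exp (l * a))" by (simp add: meas_def sum_distrib_left mult.commute)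
  also have "\<dots> \<le> (\<Sum>x\<in>?H. m x * \<phi> x)"
    using l(1) m_nonneg R by (intro sum_mono mult_left_mono) (auto simp: \<phi>_def b_def)
  also have "\<dots> \<le> (\<Sum>x\<in>G. m x * \<phi> x)"
    using m_nonneg by (intro sum_mono2) (auto simp: \<phi>_def)
  also note 2
  also have "B = exp (l * a) * exp (l * (R + 1))"
    by (simp add: B_def b_def exp_add[symmetric] algebra_simps)
  finally have "1/2 - meas m (- S) - q * w - exp (- \<rho> * R\<^sup>2)
      \<le> exp (l * (R + 1)) * (w + q * w + exp (- \<rho> * R\<^sup>2))"
    by (simp add: mult.assoc)
  also have "\<dots> \<le> exp (2 * q * (R + 1)) * (w + q * w + exp (- \<rho> * R\<^sup>2))"
  proof (intro mult_right_mono)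
    have "0 \<le> w + q * w"
    proof -
      have "0 \<le> boundary P m S" unfolding boundary_def by (intro sum_nonneg edge_weight_nonneg)
      with bd have "0 \<le> P0 P * q * w" by simp
      then have "0 \<le> w" using P0_gt_0 q by (auto simp: zero_le_mult_iff mult_le_0_iff)
      then show ?thesis using q by simp
    qed
    then show "0 \<le> w + q * w + exp (- \<rho> * R\<^sup>2)" by (simp add: add_nonneg_nonneg)
    show "exp (l * (R + 1)) \<le> exp (2 * q * (R + 1))" using l(3) R by (simp add: mult_right_mono)
  qed
  finally show ?thesis .
qed

lemma boundary_lower_bound:
  assumes W: "W \<noteq> {}" "meas m W \<le> 1/2"
  shows "P0 P / 48 * sqrt \<rho> * (meas m W * sqrt (ln (1 / meas m W))) \<le> boundary P m W"
proof -
  define w where "w = meas m W"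
  define L where "L = ln (1 / w)"
  \<comment> \<open>With this \<open>q\<close> the claim reads
    \<open>P0 P * q * w \<le> boundary P m W\<close>; \<open>R\<close> is the radius at which the
    concentration bound equals \<open>w\<close>.\<close>
  define q where "q = sqrt (\<rho> * L) / 48"
  define R where "R = sqrt (L / \<rho>)"
  have w: "0 < w" "w \<le> 1/2" using W meas_pos by (auto simp: w_def)
  have "ln 2 \<le> L" unfolding L_def using w by (subst ln_le_cancel_iff) (auto simp: field_simps)
  then have L: "L \<ge> ln 2" "L > 0" by (auto intro: less_le_trans[of 0 "ln 2"])
  have expL: "exp (- L) = w" using w by (simp add: L_def ln_div)
  have R: "R > 0" "R\<^sup>2 = L / \<rho>" "\<rho> * R\<^sup>2 = L" using L \<rho> by (auto simp: R_def)
  have q: "q > 0" "q * R = L / 48"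
    using L \<rho> by (auto simp: q_def R_def real_sqrt_mult[symmetric])
  \<comment> \<open>Balls of radius below one are single points, so concentration of
    \<open>- W\<close> at such a radius bounds \<open>w\<close> itself.\<close>
  have R1: "R \<ge> 1"
  proof (rule ccontr)
    assume "\<not> R \<ge> 1"
    then obtain r where r: "R < r" "r < 1" using dense[of R 1] by auto
    have "meas m (- W) \<ge> 1/2" using W by (simp add: meas_Compl m_sum)
    moreover have "- nbhd P (- W) r = W"
    proof (intro set_eqI)
      fix x
      have "a = x" if "d x a \<le> r" for a
      proof (rule ccontr)
        assume "a \<noteq> x"
        then have "d x a \<ge> 1" by (intro dist_ge_1) auto
        with that r show False by simp
      qed
      moreover have "d x x \<le> r" using r R(1) by (simp add: dist_self)
      ultimately show "x \<in> - nbhd P (- W) r \<longleftrightarrow> x \<in> W" unfolding nbhd_def by blast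
    qed
    moreover have "r > 0" using r R(1) by simp
    ultimately have "w \<le> exp (- \<rho> * r\<^sup>2)" using conc[of "- W" r] by (metis w_def)
    then have "exp (- L) \<le> exp (- \<rho> * r\<^sup>2)" by (simp add: expL)
    then have "\<rho> * r\<^sup>2 \<le> \<rho> * R\<^sup>2" using R by simp
    then have "r\<^sup>2 \<le> R\<^sup>2" using \<rho> by simp
    then show False using r R(1) by (simp add: power2_le_iff_abs_le)
  qed
  have "W \<noteq> UNIV" using W meas_UNIV by auto
  with W(1) obtain g C where g: "lip1 P g"
    and below: "\<And>x. x \<in> W \<Longrightarrow> \<Delta> g x \<le> C" and above: "\<And>x. x \<notin> W \<Longrightarrow> \<Delta> g x \<ge> C"
    and down: "\<And>x. x \<in> W \<Longrightarrow> x \<notin> inner_bd W \<Longrightarrow> \<exists>z. adj P x z \<and> g z = g x - 1"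
    and up: "\<And>x. x \<notin> W \<Longrightarrow> \<exists>z. adj P x z \<and> g z = g x + 1"
    using laplacian_separation[of W thesis] by blast
  have "P0 P * q * w \<le> boundary P m W"
  proof (cases "L \<le> 4")
    case True
    \<comment> \<open>The factor \<open>sqrt 3\<close> turns the tail bound into
      \<open>w ^ 3\<close>, at most \<open>w / 4\<close>, so two tails cost at most half of
      \<open>w\<close>.\<close>
    define r where "r = sqrt 3 * R"
    have r: "r > 0" "\<rho> * r\<^sup>2 = 3 * L" using R by (auto simp: r_def power_mult_distrib)
    have "exp (- \<rho> * r\<^sup>2) = w ^ 3"
      using exp_of_nat_mult[of 3 "- L"] r(2) by (simp add: expL)
    also have "\<dots> \<le> w / 4" using w mult_mono[of w "1/2" w "1/2"] by (simp add: power3_eq_cube)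
    finally have tail: "exp (- \<rho> * r\<^sup>2) \<le> w / 4" .
    have "P0 P * (w / 2) \<le> (2 * r + 2) * boundary P m W"
    \<comment> \<open>For \<open>C \<ge> 0\<close> the function \<open>g\<close> is subharmonic off
      \<open>W\<close>; otherwise \<open>- g\<close> is subharmonic on \<open>W\<close>.\<close>
    proof (cases "C \<ge> 0")
      case C: True
      have "P0 P * (meas m (- W) - 2 * exp (- \<rho> * r\<^sup>2)) \<le> (2 * r + 2) * boundary P m (- W)"
        by (rule boundary_ge_of_subharmonic[OF g _ _ r(1)]) (use C above up in force)+
      moreover have "P0 P * (w / 2) \<le> P0 P * (meas m (- W) - 2 * exp (- \<rho> * r\<^sup>2))"
        using tail w P0_gt_0 by (intro mult_left_mono) (auto simp: meas_Compl m_sum w_def)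
      ultimately show ?thesis by (simp add: boundary_Compl)
    next
      case C: False
      have "P0 P * (meas m W - 2 * exp (- \<rho> * r\<^sup>2)) \<le> (2 * r + 2) * boundary P m W"
        by (rule boundary_ge_of_subharmonic[OF lip1_uminus[OF g] _ _ r(1)])
          (use C below down in \<open>force simp: laplacian_uminus\<close>)+
      moreover have "P0 P * (w / 2) \<le> P0 P * (meas m W - 2 * exp (- \<rho> * r\<^sup>2))"
        using tail w P0_gt_0 by (intro mult_left_mono) (auto simp: w_def)
      ultimately show ?thesis by simp
    qed
    \<comment> \<open>Since \<open>r \<le> 2 * R\<close> and \<open>1 \<le> R\<close>, the left side
      is at most \<open>6 * q * R = L / 8\<close>; this is where \<open>L \<le> 4\<close>
      enters.\<close>
    moreover have "q * (2 * r + 2) \<le> 1/2"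
    proof -
      have "sqrt 3 \<le> (2 :: real)" by (rule real_le_lsqrt) auto
      then have "r \<le> 2 * R" unfolding r_def using R(1) by (intro mult_right_mono) auto
      then have "q * (2 * r + 2) \<le> q * (6 * R)" using q(1) R1 by (intro mult_left_mono) auto
      also have "\<dots> = 6 * (L / 48)" using q(2) by (metis mult.left_commute)
      finally show ?thesis using True by simp
    qed
    then have "(P0 P * w) * (q * (2 * r + 2)) \<le> (P0 P * w) * (1/2)"
      using P0_gt_0 w by (intro mult_left_mono) auto
    ultimately have "(2 * r + 2) * (P0 P * q * w) \<le> (2 * r + 2) * boundary P m W"
      by (simp add: algebra_simps)
    then show ?thesis using r by simp
  next
    case False
    show ?thesis
    proof (rule ccontr)
      assume small: "\<not> ?thesis"
      \<comment> \<open>A constant test function kills the Dirichlet form and leaves only the flux,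
        so a small boundary keeps \<open>C\<close> from being very negative.\<close>
      have "- boundary P m W \<le> (\<Sum>x\<in>W. m x * 1 * \<Delta> g x)"
      proof -
        have "- (P x y * m x * d x y) \<le> m x * P x y * 1 * (g y - g x)" for x y
          using lip1D[OF g, of x y] mult_left_mono[of "- d x y" "g y - g x" "m x * P x y"]
            m_nonneg[of x] P_nonneg[of x y] by (auto simp: algebra_simps)
        then show ?thesis unfolding Green_formula boundary_def sum_negf[symmetric]
          by (simp add: sum_mono)
      qed
      also have "\<dots> \<le> (\<Sum>x\<in>W. m x * C)"
        using below m_nonneg by (intro sum_mono) (simp add: mult_left_mono)
      also have "\<dots> = w * C" by (simp add: w_def meas_def sum_distrib_right)
      finally have "w * - (P0 P * q) \<le> w * C" using small by (simp add: algebra_simps)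
      then have C: "- (P0 P * q) \<le> C" using w by (simp only: mult_le_cancel_left_pos)
      have "1/2 - meas m (- (- W)) - q * w - exp (- \<rho> * R\<^sup>2)
           \<le> exp (2 * q * (R + 1)) * (w + q * w + exp (- \<rho> * R\<^sup>2))"
        by (rule meas_le_exp_of_small_boundary[OF g _ _ R(1) q(1)])
          (use C above up small in \<open>force simp: boundary_Compl\<close>)+
      moreover have w_eq: "exp (- \<rho> * R\<^sup>2) = w" using R(3) expL by simp
      ultimately have flux: "1/2 - w - q * w - w \<le> exp (2 * q * (R + 1)) * (w + q * w + w)"
        unfolding w_eq by (simp only: w_def double_complement)
      have "q * 1 \<le> q * R" using q(1) R1 by (intro mult_left_mono) auto
      then have qL: "q \<le> L / 48" unfolding q(2) by simp
      then have "w * q \<le> w * (L / 48)" using w(1) by (intro mult_left_mono) auto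
      then have qw: "w + q * w + w \<le> w * (2 + L / 48)" by (simp add: distrib_left mult.commute)
      \<comment> \<open>Each of the two terms is at most \<open>L / 24\<close>.\<close>
      have "2 * q * (R + 1) = 2 * (q * R) + 2 * q" by (simp add: algebra_simps)
      also have "\<dots> \<le> L / 12" using q(2) qL by simp
      finally have "exp (2 * q * (R + 1)) \<le> exp (L / 12)" by simp
      then have "exp (2 * q * (R + 1)) * (w + q * w + w) \<le> exp (L / 12) * (w * (2 + L / 48))"
        using qw w q by (intro mult_mono) auto
      with flux qw have "1/2 \<le> w * (2 + L / 48) + exp (L / 12) * (w * (2 + L / 48))" by linarith
      then show False using exp_small_sum_less_half[of L] False unfolding expL by (simp add: mult.assoc)
    qed
  qed
  then show ?thesis by (simp add: q_def real_sqrt_mult L_def w_def algebra_simps)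
qed

end

theorem theorem6p6:
  fixes P :: "'a::finite \<Rightarrow> 'a \<Rightarrow> real" and m :: "'a \<Rightarrow> real" and \<rho> :: real
  assumes "CARD('a) \<ge> 2"
    and "markov_kernel P"
    and "symmetric_support P"
    and "connected_chain P"
    and "reversible_prob P m"
    and "\<forall>x y. adj P x y \<longrightarrow> ollivier_curvature P x y \<ge> 0"
    and "\<rho> > 0"
    and "\<forall>A r. meas m A \<ge> 1/2 \<and> r > 0 \<longrightarrow> meas m (- nbhd P A r) \<le> exp (- \<rho> * r\<^sup>2)"
  shows "h_sqrt_log P m \<ge> P0 P / 48 * sqrt \<rho>"
proof -
  interpret concentrated_chain P m \<rho>
  proof unfold_locales
    show "adj P x y \<Longrightarrow> ollivier_curvature P x y \<ge> 0" for x y using assms(6) by blast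
    show "meas m A \<ge> 1/2 \<Longrightarrow> r > 0 \<Longrightarrow> meas m (- nbhd P A r) \<le> exp (- \<rho> * r\<^sup>2)" for A r
      using assms(8) by blast
  qed (rule assms)+
  \<comment> \<open>Of two distinct vertices one has mass at most 1/2, so the infimum runs over a
    nonempty set.\<close>
  obtain x y where "adj P x y" using ex_adj[OF card] by auto
  then have "x \<noteq> y" by (simp add: adj_def)
  then have "meas m {x} + meas m {y} = meas m {x, y}" by (simp add: meas_def)
  also have "\<dots> \<le> 1" using meas_mono[of m, OF m_nonneg subset_UNIV] meas_UNIV by metis
  finally have "meas m {x} \<le> 1/2 \<or> meas m {y} \<le> 1/2" by linarith
  then have "\<exists>W. W \<noteq> {} \<and> meas m W \<le> 1/2" by blast
  then show ?thesis unfolding h_sqrt_log_def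
  proof (intro cInf_greatest)
    fix t assume "t \<in> {boundary P m W / (meas m W * sqrt (ln (1 / meas m W))) | W.
                          W \<noteq> {} \<and> meas m W \<le> 1/2}"
    then obtain W where W: "W \<noteq> {}" "meas m W \<le> 1/2"
      and t: "t = boundary P m W / (meas m W * sqrt (ln (1 / meas m W)))" by auto
    have "meas m W * sqrt (ln (1 / meas m W)) > 0" using W meas_pos[OF W(1)] by simp
    then show "P0 P / 48 * sqrt \<rho> \<le> t"
      using boundary_lower_bound[OF W] by (simp add: t pos_le_divide_eq)
  qed auto
qed

end
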